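(* Let $q$ be a prime power, $n=tt'$ with integers $t,t'\ge 2$, and let $f(x)=\sum_{i=0}^{n-1}a_ix^{q^i}\in\mathbb{F}_{q^n}[x]$. Let $U_f=\{(y,f(y))\colon y\in\mathbb{F}_{q^n}\}$ and $U_f^*=U_f\setminus\{(0,0)\}$, and consider (A) $\tilde U_f=\{\langle v\rangle_{\mathbb{F}_q}\colon v\in U_f^*\}$, an $(n-1)$-dimensional subspace of $\mathrm{PG}(\mathbb{F}_{q^n}^2,\mathbb{F}_q)\cong\mathrm{PG}(2n-1,q)$; (B) $R_f=\{\langle v\rangle_{\mathbb{F}_{q^t}}\colon v\in U_f^*\}$, an $\mathbb{F}_q$-linear set of rank $n$ in $\mathrm{PG}(\mathbb{F}_{q^n}^2,\mathbb{F}_{q^t})\cong\mathrm{PG}(2t'-1,q^t)$; (C) $L_f=\{\langle v\rangle_{\mathbb{F}_{q^n}}\colon v\in U_f^*\}$, an $\mathbb{F}_q$-linear set of rank $n$ in $\mathrm{PG}(\mathbb{F}_{q^n}^2,\mathbb{F}_{q^n})\cong\mathrm{PG}(1,q^n)$. Then: (i) $|R_f|=|L_f|$ if and only if $f(x)$ is L-$q^t$-partially scattered. (ii) $R_f$ is a scattered $\mathbb{F}_q$-linear set if and only if $f(x)$ is R-$q^t$-partially scattered; in this case the map $\mu\colon\langle v\rangle_{\mathbb{F}_q}\in\tilde U_f\mapsto\langle v\rangle_{\mathbb{F}_{q^t}}\in R_f$ is bijective. (iii) If $t=2$ and $f(x)$ is R-$q^2$-partially scattered, then $R_f$ is a canonical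 $\mathbb{F}_q$-subgeometry of $\mathrm{PG}(2t'-1,q^2)$.
   Context: A $q$-polynomial $f$ over $\mathbb{F}_{q^n}$ is L-$q^t$-partially scattered if for all $y,z\in\mathbb{F}_{q^n}^*$, $f(y)/y=f(z)/z$ implies $y/z\in\mathbb{F}_{q^t}$. It is R-$q^t$-partially scattered if for all $y,z\in\mathbb{F}_{q^n}^*$, $f(y)/y=f(z)/z$ and $y/z\in\mathbb{F}_{q^t}$ together imply $y/z\in\mathbb{F}_q$. For an $\mathbb{F}_q$-subspace $U$ of an $\mathbb{F}_{q^m}$-vector space $V$, the $\mathbb{F}_q$-linear set $L_U=\{\langle v\rangle_{\mathbb{F}_{q^m}}\colon v\in U\setminus\{0\}\}\subseteq\mathrm{PG}(V,\mathbb{F}_{q^m})$ has rank $\dim_{\mathbb{F}_q}U$; the weight of a point $\langle v\rangle_{\mathbb{F}_{q^m}}$ is $\dim_{\mathbb{F}_q}(\langle v\rangle_{\mathbb{F}_{q^m}}\cap U)$, and $L_U$ is scattered if all its points have weight one. A canonical $\mathbb{F}_q$-subgeometry of $\mathrm{PG}(m-1,q^k)$ is an $\mathbb{F}_q$-linear set of rank $m$ whose projective span is the whole $\mathrm{PG}(m-1,q^k)$. *)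

theory Defs
  imports
    "HOL-Number_Theory.Prime_Powers"
    "HOL-Computational_Algebra.Polynomial"
    "HOL-Library.Product_Plus"
    "HOL-Library.Cardinality"
begin

text \<open>
  The tower of fields of orders q, q^t, q^n is given by three finite fields (as types) together
  with embeddings. A vector space over one of them is given by its scalar multiplication
  \<open>scale\<close>, and subspaces, spans and dimensions are those of the library locales
  \<open>module\<close> and \<open>vector_space\<close>.
\<close>

definition field_embedding :: "('a::field \<Rightarrow> 'b::field) \<Rightarrow> bool" where
  "field_embedding \<phi> \<longleftrightarrow>
     \<phi> 1 = 1 \<and> (\<forall>x y. \<phi> (x + y) = \<phi> x + \<phi> y) \<and> (\<forall>x y. \<phi> (x * y) = \<phi> x * \<phi> y)"

text \<open>The square of the field \<open>'b\<close>, as a vector space over \<open>'a\<close> via \<open>\<phi>\<close>.\<close>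

definition pair_scale :: "('a::field \<Rightarrow> 'b::field) \<Rightarrow> 'a \<Rightarrow> 'b \<times> 'b \<Rightarrow> 'b \<times> 'b" where
  "pair_scale \<phi> c v = (\<phi> c * fst v, \<phi> c * snd v)"

lemma vector_space_pair_scale:
  assumes "field_embedding \<phi>"
  shows "vector_space (pair_scale \<phi>)"
  using assms by unfold_locales (auto simp: field_embedding_def pair_scale_def algebra_simps)

lemma field_embedding_id: "field_embedding (\<lambda>x. x)"
  by (simp add: field_embedding_def)

lemma field_embedding_comp:
  "field_embedding \<psi> \<Longrightarrow> field_embedding \<phi> \<Longrightarrow> field_embedding (\<psi> \<circ> \<phi>)"
  by (simp add: field_embedding_def)

definition poly_graph :: "'a::field poly \<Rightarrow> ('a \<times> 'a) set" where
  "poly_graph f = {(y, poly f y) | y. True}"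


subsection \<open>Partially scattered polynomials\<close>

text \<open>Here \<open>F\<close> and \<open>K\<close> are the subfields of orders q and q^t.\<close>

definition L_partially_scattered :: "'a::field set \<Rightarrow> 'a poly \<Rightarrow> bool" where
  "L_partially_scattered K f \<longleftrightarrow>
     (\<forall>y z. y \<noteq> 0 \<longrightarrow> z \<noteq> 0 \<longrightarrow> poly f y / y = poly f z / z \<longrightarrow> y / z \<in> K)"

definition R_partially_scattered :: "'a::field set \<Rightarrow> 'a set \<Rightarrow> 'a poly \<Rightarrow> bool" where
  "R_partially_scattered F K f \<longleftrightarrow>
     (\<forall>y z. y \<noteq> 0 \<longrightarrow> z \<noteq> 0 \<longrightarrow> poly f y / y = poly f z / z \<longrightarrow> y / z \<in> K \<longrightarrow> y / z \<in> F)"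


subsection \<open>Projective spaces and linear sets\<close>

text \<open>
  The point spanned by \<open>v\<close> is represented by the one-dimensional subspace it is.
  \<open>points scale UNIV\<close> is the point set of the projective space of the whole vector space, and
  \<open>points scale U\<close> is the linear set of \<open>U\<close>. If \<open>U\<close> is itself a subspace with respect to
  \<open>scale\<close>, then \<open>points scale U\<close> is the corresponding projective subspace.
\<close>

definition proj_point :: "('a::field \<Rightarrow> 'v::ab_group_add \<Rightarrow> 'v) \<Rightarrow> 'v \<Rightarrow> 'v set" where
  "proj_point scale v = module.span scale {v}"

definition points :: "('a::field \<Rightarrow> 'v::ab_group_add \<Rightarrow> 'v) \<Rightarrow> 'v set \<Rightarrow> 'v set set" where
  "points scale U = proj_point scale ` (U - {0})"

definition proj_subspace :: "('a::field \<Rightarrow> 'v::ab_group_add \<Rightarrow> 'v) \<Rightarrow> 'v set set \<Rightarrow> bool" where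
  "proj_subspace scale X \<longleftrightarrow> (\<exists>W. module.subspace scale W \<and> X = points scale W)"

text \<open>A \<open>d\<close>-dimensional projective subspace, i.e. of vector space dimension \<open>d + 1\<close>.\<close>

definition proj_subspace_dim ::
    "('a::field \<Rightarrow> 'v::ab_group_add \<Rightarrow> 'v) \<Rightarrow> nat \<Rightarrow> 'v set set \<Rightarrow> bool" where
  "proj_subspace_dim scale d X \<longleftrightarrow>
     (\<exists>W. module.subspace scale W \<and> vector_space.dim scale W = d + 1 \<and> X = points scale W)"

definition proj_span ::
    "('a::field \<Rightarrow> 'v::ab_group_add \<Rightarrow> 'v) \<Rightarrow> 'v set set \<Rightarrow> 'v set set" where
  "proj_span scale X = proj_subspace scale hull X"

text \<open>
  In the following, \<open>s\<close> is the scalar multiplication of the small field and \<open>S\<close> that of the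
  large field on the same vector space. As rank and weights depend on \<open>U\<close> and not only on the
  point set, the subspace \<open>U\<close> is an explicit argument.
\<close>

definition linear_set_of_rank ::
    "('a::field \<Rightarrow> 'v::ab_group_add \<Rightarrow> 'v) \<Rightarrow> ('b::field \<Rightarrow> 'v \<Rightarrow> 'v) \<Rightarrow> 'v set \<Rightarrow> nat
      \<Rightarrow> 'v set set \<Rightarrow> bool" where
  "linear_set_of_rank s S U r L \<longleftrightarrow>
     module.subspace s U \<and> vector_space.dim s U = r \<and> L = points S U"

definition weight ::
    "('a::field \<Rightarrow> 'v::ab_group_add \<Rightarrow> 'v) \<Rightarrow> 'v set \<Rightarrow> 'v set \<Rightarrow> nat" where
  "weight s U P = vector_space.dim s (P \<inter> U)"

definition scattered_linear_set ::
    "('a::field \<Rightarrow> 'v::ab_group_add \<Rightarrow> 'v) \<Rightarrow> ('b::field \<Rightarrow> 'v \<Rightarrow> 'v) \<Rightarrow> 'v set \<Rightarrow> bool" where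
  "scattered_linear_set s S U \<longleftrightarrow>
     module.subspace s U \<and> (\<forall>P\<in>points S U. weight s U P = 1)"

definition canonical_subgeometry ::
    "('a::field \<Rightarrow> 'v::ab_group_add \<Rightarrow> 'v) \<Rightarrow> ('b::field \<Rightarrow> 'v \<Rightarrow> 'v) \<Rightarrow> nat \<Rightarrow> 'v set
      \<Rightarrow> 'v set set \<Rightarrow> bool" where
  "canonical_subgeometry s S m U L \<longleftrightarrow>
     proj_subspace_dim S (m - 1) (points S UNIV) \<and>
     linear_set_of_rank s S U m L \<and> proj_span S L = points S UNIV"

end

theory Submission
  imports Defs
begin

text \<open>
  All assertions reduce to one observation: two vectors \<open>(y, f y)\<close> and \<open>(z, f z)\<close> span the same
  point over a subfield \<open>K\<close> iff \<open>f y / y = f z / z\<close> and \<open>y / z \<in> K\<close>. Hence (i) says that the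
  surjection from \<open>R\<close> to \<open>L\<close> is injective iff \<open>f\<close> is L-partially scattered, and (ii) that a point of
  \<open>R\<close> meets \<open>U\<close> in a single point over the small field iff \<open>f\<close> is R-partially scattered. For (iii)
  take \<open>\<omega>\<close> in the quadratic extension but not in the small field: scatteredness gives
  \<open>U \<inter> \<omega>U = 0\<close>, so \<open>U + \<omega>U\<close> is the whole space by counting. Dimensions are obtained from
  cardinalities.
\<close>

section \<open>Vector spaces over finite fields\<close>

text \<open>Adjoining \<open>b\<close> outside \<open>span B\<close> makes every vector of the new
  span uniquely of the form \<open>scale k b + w\<close> with \<open>w\<close> in
  \<open>span B\<close>, so the size is multiplied by the order of the field.\<close>

lemma card_span_independent:
  fixes scale :: "'a::{field,finite} \<Rightarrow> 'v::ab_group_add \<Rightarrow> 'v"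
  assumes vs: "vector_space scale" and "finite B" and "\<not> module.dependent scale B"
  shows "card (module.span scale B) = CARD('a) ^ card B"
proof -
  interpret vector_space scale by (rule vs)
  show ?thesis
    using assms(2,3)
  proof (induction B rule: finite_induct)
    case empty
    then show ?case by simp
  next
    case (insert b B)
    have ind: "independent B" and b: "b \<notin> span B"
      using insert.prems insert.hyps by (auto simp: independent_insert)
    let ?h = "\<lambda>(k, w). scale k b + w"
    have "bij_betw ?h (UNIV \<times> span B) (span (insert b B))"
      unfolding bij_betw_def
    proof
      show "inj_on ?h (UNIV \<times> span B)"
      proof (rule inj_onI, clarify)
        fix k w k' w'
        assume w: "w \<in> span B" "w' \<in> span B" and eq: "scale k b + w = scale k' b + w'"
        from eq have "scale (k - k') b = w' - w"
          by (simp add: scale_left_diff_distrib algebra_simps)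
        then have "scale (k - k') b \<in> span B"
          using w by (simp add: span_diff)
        then have "k = k'"
          using b span_scale[of "scale (k - k') b" B "inverse (k - k')"] by (cases "k = k'") auto
        with eq show "k = k' \<and> w = w'" by simp
      qed
      show "?h ` (UNIV \<times> span B) = span (insert b B)"
      proof
        show "?h ` (UNIV \<times> span B) \<subseteq> span (insert b B)"
          using span_mono[OF subset_insertI[of B b]] span_base[of b "insert b B"]
          by (auto intro!: span_add span_scale)
        show "span (insert b B) \<subseteq> ?h ` (UNIV \<times> span B)"
        proof
          fix x assume "x \<in> span (insert b B)"
          then obtain k where "x - scale k b \<in> span B"
            by (auto simp: span_breakdown_eq)
          then show "x \<in> ?h ` (UNIV \<times> span B)"
            by (intro image_eqI[of _ _ "(k, x - scale k b)"]) auto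
        qed
      qed
    qed
    then show ?case
      using insert.IH[OF ind] insert.hyps
      by (simp add: bij_betw_same_card[symmetric] card_cartesian_product)
  qed
qed

lemma card_subspace:
  fixes scale :: "'a::{field,finite} \<Rightarrow> 'v::ab_group_add \<Rightarrow> 'v"
  assumes vs: "vector_space scale" and W: "module.subspace scale W" and fin: "finite W"
  shows "card W = CARD('a) ^ vector_space.dim scale W"
proof -
  interpret vector_space scale by (rule vs)
  obtain B where B: "B \<subseteq> W" "independent B" "W \<subseteq> span B" "card B = dim W"
    by (rule basis_exists)
  have "span B = W"
    using B W by (simp add: span_minimal subset_antisym)
  then show ?thesis
    using card_span_independent[OF vs _ B(2)] B finite_subset[OF B(1) fin] by simp
qed

lemma dim_eqI_card:
  fixes scale :: "'a::{field,finite} \<Rightarrow> 'v::ab_group_add \<Rightarrow> 'v"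
  assumes "vector_space scale" "module.subspace scale W" "finite W" "card W = CARD('a) ^ d"
  shows "vector_space.dim scale W = d"
proof -
  \<comment> \<open>A field has at least the two elements 0 and 1; a base greater than 1 makes the
    exponent unique.\<close>
  have "card (UNIV :: 'a set) \<ge> card {0 :: 'a, 1}"
    by (intro card_mono) auto
  then have "CARD('a) > 1" by simp
  then show ?thesis
    using card_subspace[OF assms(1-3)] assms(4) by simp
qed

lemma dim_eq_1_iff:
  assumes vs: "vector_space scale" and W: "module.subspace scale W" and u: "u \<in> W" "u \<noteq> 0"
  shows "vector_space.dim scale W = 1 \<longleftrightarrow> W = module.span scale {u}"
proof -
  interpret vector_space scale by (rule vs)
  show ?thesis
  proof
    assume "dim W = 1"
    then obtain b where b: "b \<in> W" "W \<subseteq> span {b}"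
      by (metis basis_exists card_1_singletonE insert_subset)
    \<comment> \<open>Exchange: \<open>u\<close> lies in \<open>span {b}\<close> but, being nonzero,
      not in the span of the empty set.\<close>
    then have "b \<in> span {u}"
      using u in_span_insert[of u b "{}"] by auto
    then have "span {b} \<subseteq> span {u}"
      by (simp add: span_minimal)
    moreover have "span {u} \<subseteq> W"
      using u W by (simp add: span_minimal)
    ultimately show "W = span {u}"
      using b by blast
  next
    have "independent {u}" using u by simp
    assume "W = span {u}"
    then show "dim W = 1"
      using dim_eq_card_independent[OF \<open>independent {u}\<close>] by simp
  qed
qed

section \<open>Points and linear sets\<close>

lemma proj_point_eq_range:
  assumes "vector_space scale"
  shows "proj_point scale v = range (\<lambda>c. scale c v)"
proof -
  interpret vector_space scale by (rule assms)
  show ?thesis by (simp add: proj_point_def span_singleton)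
qed

lemma proj_point_self:
  assumes "vector_space scale"
  shows "v \<in> proj_point scale v"
proof -
  interpret vector_space scale by (rule assms)
  show ?thesis by (simp add: proj_point_def span_base)
qed

lemma proj_point_eq_iff:
  assumes vs: "vector_space scale" and u: "u \<noteq> 0"
  shows "proj_point scale u = proj_point scale v \<longleftrightarrow> u \<in> proj_point scale v"
proof
  interpret vector_space scale by (rule vs)
  assume "u \<in> proj_point scale v"
  then have uv: "u \<in> span {v}" by (simp add: proj_point_def)
  then have "v \<in> span {u}"
    using u in_span_insert[of u v "{}"] by auto
  with uv show "proj_point scale u = proj_point scale v"
    unfolding proj_point_def by (simp add: span_minimal subset_antisym)
qed (metis proj_point_self[OF vs])

text \<open>Each nonzero vector lies in the point it spans, and a subspace contains the point
  spanned by any of its vectors. Inclusions of point sets thus become inclusions of vector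
  sets.\<close>

lemma points_subset_points_iff:
  assumes vs: "vector_space scale" and W: "module.subspace scale W"
  shows "points scale U \<subseteq> points scale W \<longleftrightarrow> U \<subseteq> W"
proof
  interpret vector_space scale by (rule vs)
  assume sub: "points scale U \<subseteq> points scale W"
  show "U \<subseteq> W"
  proof
    fix u assume u: "u \<in> U"
    show "u \<in> W"
    proof (cases "u = 0")
      case True
      then show ?thesis using W by (simp add: subspace_0)
    next
      case False
      then obtain w where w: "w \<in> W" "proj_point scale u = proj_point scale w"
        using u sub by (auto simp: points_def)
      then have "u \<in> span {w}"
        using proj_point_self[OF vs, of u] by (simp add: proj_point_def)
      then show ?thesis
        using w W span_minimal[of "{w}" W] by auto
    qed
  qed
qed (auto simp: points_def)

lemma proj_span_points:
  assumes vs: "vector_space scale"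
  shows "proj_span scale (points scale U) = points scale (module.span scale U)"
proof -
  interpret vector_space scale by (rule vs)
  show ?thesis
    unfolding proj_span_def
  proof (rule hull_unique)
    show "points scale U \<subseteq> points scale (span U)"
      by (simp add: points_subset_points_iff[OF vs] span_superset)
    show "proj_subspace scale (points scale (span U))"
      by (auto simp: proj_subspace_def)
    fix X assume X: "points scale U \<subseteq> X" "proj_subspace scale X"
    then obtain W where W: "subspace W" "X = points scale W"
      by (auto simp: proj_subspace_def)
    then have "span U \<subseteq> W"
      using X by (simp add: points_subset_points_iff[OF vs] span_minimal)
    then show "points scale (span U) \<subseteq> X"
      using W by (simp add: points_subset_points_iff[OF vs])
  qed
qed

text \<open>By \<open>restrict\<close> small scalars act as large ones, so a large point meets
  \<open>U\<close> in a small subspace. Weight one means that this subspace is the small point of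
  any nonzero vector in it. This turns weights into a comparison of two equivalence relations on
  \<open>U - {0}\<close>.\<close>

lemma scattered_linear_set_iff:
  assumes s: "vector_space s" and S: "vector_space S"
    and restrict: "\<And>c v. \<exists>d. s c v = S d v"
    and U: "module.subspace s U"
  shows "scattered_linear_set s S U \<longleftrightarrow>
    (\<forall>u\<in>U - {0}. \<forall>v\<in>U - {0}. proj_point S u = proj_point S v \<longrightarrow> proj_point s u = proj_point s v)"
proof -
  interpret s: vector_space s by (rule s)
  interpret S: vector_space S by (rule S)
  have sub: "s.subspace (proj_point S v \<inter> U)" for v
  proof (rule s.subspace_inter[OF _ U])
    show "s.subspace (proj_point S v)"
      using restrict unfolding proj_point_def
      by (intro s.subspaceI) (metis S.span_zero S.span_add S.span_scale)+
  qed
  have "weight s U (proj_point S v) = 1 \<longleftrightarrow>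
      (\<forall>u\<in>U - {0}. proj_point S u = proj_point S v \<longrightarrow> proj_point s u = proj_point s v)"
    if v: "v \<in> U - {0}" for v
  proof -
    have "v \<in> proj_point S v \<inter> U"
      using v proj_point_self[OF S] by auto
    then have "weight s U (proj_point S v) = 1 \<longleftrightarrow> proj_point S v \<inter> U = proj_point s v"
      using v dim_eq_1_iff[OF s sub] by (simp add: weight_def proj_point_def)
    also have "\<dots> \<longleftrightarrow> proj_point S v \<inter> U \<subseteq> proj_point s v"
    proof -
      have "proj_point s v \<subseteq> proj_point S v \<inter> U"
        using \<open>v \<in> proj_point S v \<inter> U\<close> s.span_minimal[OF _ sub, of "{v}" v]
        by (simp add: proj_point_def[of s])
      then show ?thesis by blast
    qed
    \<comment> \<open>The zero vector lies in every point and can be left out.\<close>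
    also have "\<dots> \<longleftrightarrow> (\<forall>u\<in>U - {0}. u \<in> proj_point S v \<longrightarrow> u \<in> proj_point s v)"
      using s.span_zero by (auto simp: proj_point_def)
    finally show ?thesis
      by (simp add: proj_point_eq_iff[OF s] proj_point_eq_iff[OF S])
  qed
  then have "(\<forall>P\<in>points S U. weight s U P = 1) \<longleftrightarrow>
      (\<forall>v\<in>U - {0}. \<forall>u\<in>U - {0}.
        proj_point S u = proj_point S v \<longrightarrow> proj_point s u = proj_point s v)"
    unfolding points_def by simp
  then show ?thesis
    using U unfolding scattered_linear_set_def by blast
qed

text \<open>The assumption on \<open>\<omega>\<close> expresses that it is not a scalar of the small
  field, without naming an embedding of one field into the other.\<close>

lemma span_scattered_linear_set:
  fixes s :: "'a::field \<Rightarrow> 'v::{ab_group_add,finite} \<Rightarrow> 'v" and S :: "'b::field \<Rightarrow> 'v \<Rightarrow> 'v"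
  assumes s: "vector_space s" and S: "vector_space S"
    and restrict: "\<And>c v. \<exists>d. s c v = S d v"
    and scattered: "scattered_linear_set s S U"
    and \<omega>: "\<And>c v. v \<noteq> 0 \<Longrightarrow> S \<omega> v \<noteq> s c v"
    and card: "card U ^ 2 = CARD('v)"
  shows "module.span S U = UNIV"
proof -
  interpret s: vector_space s by (rule s)
  interpret S: vector_space S by (rule S)
  have U: "s.subspace U"
    using scattered by (simp add: scattered_linear_set_def)
  have disjoint: "d = 0" if d: "d \<in> U" "S \<omega> d \<in> U" for d
  proof (rule ccontr)
    assume "d \<noteq> 0"
    \<comment> \<open>The case \<open>c = 0\<close> of the assumption on
      \<open>\<omega>\<close>.\<close>
    moreover have "S \<omega> d \<noteq> 0"
      using \<omega>[OF \<open>d \<noteq> 0\<close>, of 0] by simp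
    moreover from this have "proj_point S (S \<omega> d) = proj_point S d"
      by (simp add: proj_point_eq_iff[OF S]) (simp add: proj_point_eq_range[OF S])
    ultimately have "proj_point s (S \<omega> d) = proj_point s d"
      using scattered d unfolding scattered_linear_set_iff[OF s S restrict U] by blast
    then have "S \<omega> d \<in> proj_point s d"
      using proj_point_self[OF s, of "S \<omega> d"] by simp
    then show False
      using \<omega>[OF \<open>d \<noteq> 0\<close>] by (auto simp: proj_point_eq_range[OF s])
  qed
  let ?h = "\<lambda>(u, u'). u + S \<omega> u'"
  have "inj_on ?h (U \<times> U)"
  proof (rule inj_onI, clarify)
    fix u u' v v'
    assume in_U: "u \<in> U" "u' \<in> U" "v \<in> U" "v' \<in> U" and eq: "u + S \<omega> u' = v + S \<omega> v'"
    \<comment> \<open>Both \<open>u' - v'\<close> and its multiple by \<open>\<omega>\<close> now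
      lie in \<open>U\<close>.\<close>
    from eq have "S \<omega> (u' - v') = v - u"
      by (simp add: S.scale_right_diff_distrib algebra_simps)
    then have "u' - v' = 0"
      using in_U U by (intro disjoint) (auto intro: s.subspace_diff)
    with eq show "u = v \<and> u' = v'" by simp
  qed
  then have "card (?h ` (U \<times> U)) = CARD('v)"
    using card by (simp add: card_image card_cartesian_product power2_eq_square)
  then have "?h ` (U \<times> U) = UNIV"
    by (intro card_subset_eq) auto
  moreover have "?h ` (U \<times> U) \<subseteq> S.span U"
    by (auto intro: S.span_add S.span_scale S.span_base)
  ultimately show ?thesis by blast
qed

section \<open>Pairs of maps on a set\<close>

text \<open>Maps with the same fibres on \<open>A\<close> have images in natural bijection: send a
  value of \<open>g\<close> to the value of \<open>h\<close> at any preimage.\<close>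

lemma bij_betw_images:
  assumes "\<And>x y. x \<in> A \<Longrightarrow> y \<in> A \<Longrightarrow> g x = g y \<longleftrightarrow> h x = h y"
  shows "\<exists>\<mu>. (\<forall>x\<in>A. \<mu> (g x) = h x) \<and> bij_betw \<mu> (g ` A) (h ` A)"
proof -
  have \<mu>: "h (inv_into A g (g x)) = h x" if "x \<in> A" for x
    using assms that by (metis f_inv_into_f image_eqI inv_into_into)
  then have "bij_betw (\<lambda>p. h (inv_into A g p)) (g ` A) (h ` A)"
    using assms by (auto simp: bij_betw_def inj_on_def image_image)
  with \<mu> show ?thesis
    by (intro exI[of _ "\<lambda>p. h (inv_into A g p)"]) auto
qed

text \<open>Here \<open>h\<close> factors through \<open>g\<close>, which gives a surjection between
  the images. For finite sets of equal size, and only then, it is injective.\<close>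

lemma card_images_eq_iff:
  assumes fin: "finite A"
    and refines: "\<And>x y. x \<in> A \<Longrightarrow> y \<in> A \<Longrightarrow> g x = g y \<Longrightarrow> h x = h y"
  shows "card (g ` A) = card (h ` A) \<longleftrightarrow> (\<forall>x\<in>A. \<forall>y\<in>A. h x = h y \<longrightarrow> g x = g y)"
proof -
  define \<mu> where "\<mu> p = h (inv_into A g p)" for p
  have \<mu>: "\<mu> (g x) = h x" if "x \<in> A" for x
    using refines that unfolding \<mu>_def by (metis f_inv_into_f image_eqI inv_into_into)
  then have "\<mu> ` g ` A = h ` A"
    by (auto simp: image_image)
  then have "card (g ` A) = card (h ` A) \<longleftrightarrow> inj_on \<mu> (g ` A)"
    using fin by (metis inj_on_iff_eq_card finite_imageI)
  also have "\<dots> \<longleftrightarrow> (\<forall>x\<in>A. \<forall>y\<in>A. h x = h y \<longrightarrow> g x = g y)"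
    using \<mu> by (auto simp: inj_on_def)
  finally show ?thesis .
qed

section \<open>Field embeddings and linearized polynomials\<close>

lemma field_embedding_power: "field_embedding \<phi> \<Longrightarrow> \<phi> (x ^ k) = \<phi> x ^ k"
  by (induction k) (auto simp: field_embedding_def)

text \<open>If \<open>x - y\<close> were nonzero, its image would be a unit, but additivity makes
  that image zero.\<close>

lemma field_embedding_eq_iff:
  assumes "field_embedding \<phi>"
  shows "\<phi> x = \<phi> y \<longleftrightarrow> x = y"
proof
  assume eq: "\<phi> x = \<phi> y"
  have "\<phi> x = \<phi> (x - y) + \<phi> y"
    using assms unfolding field_embedding_def by (metis diff_add_cancel)
  then have "\<phi> (x - y) = 0" using eq by simp
  moreover have "\<phi> (x - y) * \<phi> (inverse (x - y)) = 1" if "x \<noteq> y"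
    using assms that unfolding field_embedding_def by (metis eq_iff_diff_eq_0 right_inverse)
  ultimately show "x = y" by auto
qed simp

text \<open>Powers with exponent \<open>q ^ i\<close> are iterates of Frobenius, hence additive, and
  they fix every \<open>c\<close> with \<open>c ^ q = c\<close>.\<close>

lemma poly_linearized:
  fixes a :: "nat \<Rightarrow> 'a::finite_field"
  assumes q: "primepow q" and card: "CARD('a) = q ^ n"
  defines "f \<equiv> \<Sum>i<n. monom (a i) (q ^ i)"
  shows "poly f (x + y) = poly f x + poly f y"
    and "c ^ q = c \<Longrightarrow> poly f (c * x) = c * poly f x"
proof -
  obtain p k where p: "prime p" "q = p ^ k"
    using q by (auto simp: primepow_def)
  have char: "prime CHAR('a)"
    by (simp add: prime_CHAR_semidom finite_imp_CHAR_pos)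
  have "CHAR('a) dvd p ^ (k * n)"
  proof -
    \<comment> \<open>Translation by 1 permutes the field, so comparing the two sums shows that the
      order of the field vanishes in it. Hence the characteristic divides a power of
      \<open>p\<close>.\<close>
    have "(\<Sum>x\<in>UNIV. x + 1) = (\<Sum>x\<in>UNIV. x :: 'a)"
      by (rule sum.reindex_bij_betw) (auto intro!: bij_betwI[of _ _ _ "\<lambda>x. x - 1"])
    then have "of_nat CARD('a) = (0 :: 'a)"
      by (simp add: sum.distrib)
    then show ?thesis
      unfolding of_nat_eq_0_iff_char_dvd using card p by (simp only: power_mult)
  qed
  then have "CHAR('a) = p"
    using char p(1) by (metis prime_dvd_power primes_dvd_imp_eq)
  then have "q ^ i = CHAR('a) ^ (k * i)" for i
    using p by (simp add: power_mult)
  then have frob: "(x + y) ^ (q ^ i) = x ^ (q ^ i) + y ^ (q ^ i)" for i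
    using freshmans_dream'[OF char] by blast
  have f: "poly f z = (\<Sum>i<n. a i * z ^ (q ^ i))" for z
    by (simp add: f_def poly_sum poly_monom)
  show "poly f (x + y) = poly f x + poly f y"
    by (simp add: f frob distrib_left sum.distrib)
  assume c: "c ^ q = c"
  have "c ^ (q ^ i) = c" for i
    by (induction i) (simp_all add: power_mult c)
  then show "poly f (c * x) = c * poly f x"
    by (simp add: f power_mult_distrib sum_distrib_left algebra_simps)
qed

text \<open>The first coordinate forces the proportionality factor to be \<open>y / z\<close>; the
  second then says that the two quotients agree.\<close>

lemma proj_point_poly_graph_eq_iff:
  assumes \<phi>: "field_embedding \<phi>" and "y \<noteq> 0" "z \<noteq> 0"
  shows "proj_point (pair_scale \<phi>) (y, poly f y) = proj_point (pair_scale \<phi>) (z, poly f z) \<longleftrightarrow>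
    poly f y / y = poly f z / z \<and> y / z \<in> range \<phi>"
proof -
  have "(y, poly f y) \<noteq> 0" using assms by (simp add: zero_prod_def)
  then have "proj_point (pair_scale \<phi>) (y, poly f y) = proj_point (pair_scale \<phi>) (z, poly f z) \<longleftrightarrow>
      (\<exists>c. y = \<phi> c * z \<and> poly f y = \<phi> c * poly f z)"
    using vector_space_pair_scale[OF \<phi>]
    by (simp add: proj_point_eq_iff) (auto simp: proj_point_eq_range pair_scale_def)
  also have "\<dots> \<longleftrightarrow> (\<exists>c. y / z = \<phi> c \<and> poly f y / y = poly f z / z)"
    using assms(2,3) by (intro ex_cong1) (auto simp: field_simps)
  finally show ?thesis by auto
qed

theorem theorem2p3:
  fixes q n t t' :: nat
    and \<alpha> :: "'fq::finite_field \<Rightarrow> 'fqt::finite_field"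
    and \<beta> :: "'fqt \<Rightarrow> 'fqn::finite_field"
    and a :: "nat \<Rightarrow> 'fqn"
    and f :: "'fqn poly"
  defines "s\<^sub>q \<equiv> pair_scale (\<beta> \<circ> \<alpha>)"
    and "s\<^sub>t \<equiv> pair_scale \<beta>"
    and "s\<^sub>n \<equiv> pair_scale (\<lambda>x::'fqn. x)"
    and "F\<^sub>q \<equiv> range (\<beta> \<circ> \<alpha>)"
    and "F\<^sub>t \<equiv> range \<beta>"
    and "U \<equiv> poly_graph f"
  defines "A \<equiv> points s\<^sub>q U"
    and "R \<equiv> points s\<^sub>t U"
    and "L \<equiv> points s\<^sub>n U"
  assumes "primepow q" and "t \<ge> 2" and "t' \<ge> 2" and "n = t * t'"
    and "CARD('fq) = q" and "CARD('fqt) = q ^ t" and "CARD('fqn) = q ^ n"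
    and "field_embedding \<alpha>" and "field_embedding \<beta>"
    and "f = (\<Sum>i<n. monom (a i) (q ^ i))"
  shows
    \<comment> \<open>the assertions made in (A), (B), (C), then (i), (ii), (iii)\<close>
    "(proj_subspace_dim s\<^sub>q (2 * n - 1) (points s\<^sub>q UNIV) \<and> proj_subspace_dim s\<^sub>q (n - 1) A) \<and>
     (proj_subspace_dim s\<^sub>t (2 * t' - 1) (points s\<^sub>t UNIV) \<and> linear_set_of_rank s\<^sub>q s\<^sub>t U n R) \<and>
     (proj_subspace_dim s\<^sub>n 1 (points s\<^sub>n UNIV) \<and> linear_set_of_rank s\<^sub>q s\<^sub>n U n L) \<and>
     (card R = card L \<longleftrightarrow> L_partially_scattered F\<^sub>t f) \<and>
     ((scattered_linear_set s\<^sub>q s\<^sub>t U \<longleftrightarrow> R_partially_scattered F\<^sub>q F\<^sub>t f) \<and>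
      (scattered_linear_set s\<^sub>q s\<^sub>t U \<longrightarrow>
         (\<exists>\<mu>. (\<forall>v\<in>U - {0}. \<mu> (proj_point s\<^sub>q v) = proj_point s\<^sub>t v) \<and> bij_betw \<mu> A R))) \<and>
     (t = 2 \<and> R_partially_scattered F\<^sub>q F\<^sub>t f \<longrightarrow> canonical_subgeometry s\<^sub>q s\<^sub>t (2 * t') U R)"
proof -
  note q = \<open>primepow q\<close> and t = \<open>t \<ge> 2\<close> and t' = \<open>t' \<ge> 2\<close> and n = \<open>n = t * t'\<close>
    and cards = \<open>CARD('fq) = q\<close> \<open>CARD('fqt) = q ^ t\<close> \<open>CARD('fqn) = q ^ n\<close>
    and \<alpha> = \<open>field_embedding \<alpha>\<close> and \<beta> = \<open>field_embedding \<beta>\<close>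
    and f = \<open>f = (\<Sum>i<n. monom (a i) (q ^ i))\<close>
  have \<beta>\<alpha>: "field_embedding (\<beta> \<circ> \<alpha>)"
    using \<alpha> \<beta> by (rule field_embedding_comp[rotated])
  have vs: "vector_space s\<^sub>q" "vector_space s\<^sub>t" "vector_space s\<^sub>n"
    unfolding s\<^sub>q_def s\<^sub>t_def s\<^sub>n_def
    by (intro vector_space_pair_scale \<alpha> \<beta> \<beta>\<alpha> field_embedding_id)+
  interpret q: vector_space s\<^sub>q by (rule vs)
  interpret t: vector_space s\<^sub>t by (rule vs)
  interpret n: vector_space s\<^sub>n by (rule vs)

  have q1: "q > 1"
    using primepow_gt_Suc_0[OF q] by simp
  have n_pos: "n > 0" using t t' n by simp

  have add: "poly f (x + y) = poly f x + poly f y" for x y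
    unfolding f using q cards(3) by (rule poly_linearized(1))
  have scale: "poly f (\<beta> (\<alpha> c) * x) = \<beta> (\<alpha> c) * poly f x" for c x
  proof -
    \<comment> \<open>Elements of the smallest field satisfy \<open>c ^ q = c\<close>, and
      embeddings preserve this.\<close>
    have "\<beta> (\<alpha> c) ^ q = \<beta> (\<alpha> (c ^ CARD('fq)))"
      using cards(1) by (simp add: field_embedding_power[OF \<alpha>] field_embedding_power[OF \<beta>])
    then have "\<beta> (\<alpha> c) ^ q = \<beta> (\<alpha> c)"
      by (simp add: finite_field_power_card_eq_same)
    with q cards(3) show ?thesis
      unfolding f by (rule poly_linearized(2))
  qed
  have f0: "poly f 0 = 0"
    by (metis add add_0 add_cancel_right_right)

  \<comment> \<open>Cardinalities, dimensions and ranks\<close>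
  have sub: "q.subspace U"
  proof (rule q.subspaceI)
    show "0 \<in> U" using f0 by (simp add: U_def poly_graph_def zero_prod_def)
    show "x + y \<in> U" if "x \<in> U" "y \<in> U" for x y
      using that add by (auto simp: U_def poly_graph_def)
    show "s\<^sub>q c x \<in> U" if "x \<in> U" for c x
      using that scale by (auto simp: U_def poly_graph_def s\<^sub>q_def pair_scale_def)
  qed
  have card_U: "card U = q ^ n"
  proof -
    have "U = (\<lambda>y. (y, poly f y)) ` UNIV"
      by (auto simp: U_def poly_graph_def)
    then show ?thesis
      using cards(3) by (simp add: card_image inj_on_def)
  qed
  have card_V: "CARD('fqn \<times> 'fqn) = q ^ (2 * n)"
    using cards(3) by (simp add: power_mult power2_eq_square power_mult_distrib mult.commute)

  have dim_U: "q.dim U = n"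
    using dim_eqI_card[OF vs(1) sub] card_U cards(1) by simp
  \<comment> \<open>Since \<open>n = t * t'\<close>, the number \<open>q ^ (2 * n)\<close> is also
    the power of \<open>q ^ t\<close> with exponent \<open>2 * t'\<close> and the square of
    \<open>q ^ n\<close>.\<close>
  have dims: "q.dim UNIV = 2 * n" "t.dim UNIV = 2 * t'" "n.dim UNIV = 2"
    by (rule dim_eqI_card[OF vs(1)] dim_eqI_card[OF vs(2)] dim_eqI_card[OF vs(3)];
        simp only: finite card_V cards q.subspace_UNIV t.subspace_UNIV n.subspace_UNIV n
          mult_ac flip: power_mult)+
  have proj_dims:
    "proj_subspace_dim s\<^sub>q (2 * n - 1) (points s\<^sub>q UNIV)"
    "proj_subspace_dim s\<^sub>t (2 * t' - 1) (points s\<^sub>t UNIV)"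
    "proj_subspace_dim s\<^sub>n 1 (points s\<^sub>n UNIV)"
    "proj_subspace_dim s\<^sub>q (n - 1) A"
    unfolding proj_subspace_dim_def A_def
    using n_pos t' dims dim_U sub
    by (intro exI[of _ UNIV] exI[of _ U] conjI q.subspace_UNIV t.subspace_UNIV n.subspace_UNIV; simp)+
  have ranks: "linear_set_of_rank s\<^sub>q s\<^sub>t U n R" "linear_set_of_rank s\<^sub>q s\<^sub>n U n L"
    using sub dim_U by (simp_all add: linear_set_of_rank_def R_def L_def)

  \<comment> \<open>Points spanned by vectors of the graph\<close>
  have U_nz: "U - {0} = (\<lambda>y. (y, poly f y)) ` (- {0})"
    using f0 by (auto simp: U_def poly_graph_def zero_prod_def)
  have point_eq:
    "proj_point s\<^sub>q (y, poly f y) = proj_point s\<^sub>q (z, poly f z) \<longleftrightarrow>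
      poly f y / y = poly f z / z \<and> y / z \<in> F\<^sub>q"
    "proj_point s\<^sub>t (y, poly f y) = proj_point s\<^sub>t (z, poly f z) \<longleftrightarrow>
      poly f y / y = poly f z / z \<and> y / z \<in> F\<^sub>t"
    \<comment> \<open>Over the largest field the embedding is the identity, so the condition on
      \<open>y / z\<close> is vacuous.\<close>
    "proj_point s\<^sub>n (y, poly f y) = proj_point s\<^sub>n (z, poly f z) \<longleftrightarrow>
      poly f y / y = poly f z / z"
    if "y \<noteq> 0" "z \<noteq> 0" for y z
    using that unfolding s\<^sub>q_def s\<^sub>t_def s\<^sub>n_def F\<^sub>q_def F\<^sub>t_def
    by (simp_all add: proj_point_poly_graph_eq_iff \<beta> \<beta>\<alpha> field_embedding_id)
  have F_le: "F\<^sub>q \<subseteq> F\<^sub>t"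
    by (auto simp: F\<^sub>q_def F\<^sub>t_def)
  have coarser:
    "proj_point s\<^sub>q u = proj_point s\<^sub>q v \<Longrightarrow> proj_point s\<^sub>t u = proj_point s\<^sub>t v"
    "proj_point s\<^sub>t u = proj_point s\<^sub>t v \<Longrightarrow> proj_point s\<^sub>n u = proj_point s\<^sub>n v"
    if uv: "u \<in> U - {0}" "v \<in> U - {0}" for u v
  proof -
    obtain y z where "u = (y, poly f y)" "v = (z, poly f z)" and yz: "y \<noteq> 0" "z \<noteq> 0"
      using uv unfolding U_nz by blast
    then show
      "proj_point s\<^sub>q u = proj_point s\<^sub>q v \<Longrightarrow> proj_point s\<^sub>t u = proj_point s\<^sub>t v"
      "proj_point s\<^sub>t u = proj_point s\<^sub>t v \<Longrightarrow> proj_point s\<^sub>n u = proj_point s\<^sub>n v"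
      using F_le by (simp_all add: point_eq[OF yz] subset_iff)
  qed

  \<comment> \<open>The assertions (i), (ii) and (iii)\<close>
  have i: "card R = card L \<longleftrightarrow> L_partially_scattered F\<^sub>t f"
  proof -
    have "card R = card L \<longleftrightarrow> (\<forall>u\<in>U - {0}. \<forall>v\<in>U - {0}.
        proj_point s\<^sub>n u = proj_point s\<^sub>n v \<longrightarrow> proj_point s\<^sub>t u = proj_point s\<^sub>t v)"
      unfolding R_def L_def points_def
      by (rule card_images_eq_iff) (simp, use coarser in blast)
    also have "\<dots> \<longleftrightarrow> L_partially_scattered F\<^sub>t f"
      by (auto simp: U_nz point_eq L_partially_scattered_def)
    finally show ?thesis .
  qed

  have restrict: "\<exists>d. s\<^sub>q c v = s\<^sub>t d v" for c v
    by (auto simp: s\<^sub>q_def s\<^sub>t_def pair_scale_def)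
  note scattered_iff = scattered_linear_set_iff[OF vs(1,2) restrict sub]
  have ii: "scattered_linear_set s\<^sub>q s\<^sub>t U \<longleftrightarrow> R_partially_scattered F\<^sub>q F\<^sub>t f"
    unfolding scattered_iff by (auto simp: U_nz point_eq R_partially_scattered_def)

  have bij: "\<exists>\<mu>. (\<forall>v\<in>U - {0}. \<mu> (proj_point s\<^sub>q v) = proj_point s\<^sub>t v) \<and> bij_betw \<mu> A R"
    if "scattered_linear_set s\<^sub>q s\<^sub>t U"
    unfolding A_def R_def points_def
  proof (rule bij_betw_images)
    \<comment> \<open>Scatteredness supplies the converse of \<open>coarser(1)\<close>, so both
      kinds of points have the same fibres.\<close>
    fix u v assume uv: "u \<in> U - {0}" "v \<in> U - {0}"
    with that show "proj_point s\<^sub>q u = proj_point s\<^sub>q v \<longleftrightarrow> proj_point s\<^sub>t u = proj_point s\<^sub>t v"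
      unfolding scattered_iff using coarser(1) by blast
  qed

  have iii: "canonical_subgeometry s\<^sub>q s\<^sub>t (2 * t') U R"
    if "t = 2" and "R_partially_scattered F\<^sub>q F\<^sub>t f"
  proof -
    \<comment> \<open>Counting yields \<open>\<omega>\<close>: the image of the small field has at
      most \<open>q\<close> elements, the quadratic extension \<open>q ^ 2\<close>.\<close>
    have "card (range \<alpha>) \<le> q"
      using card_image_le[of UNIV \<alpha>] cards(1) by simp
    also have "q < CARD('fqt)"
      using q1 cards(2) \<open>t = 2\<close> by (simp add: power2_eq_square)
    finally have "range \<alpha> \<noteq> UNIV" by auto
    then obtain \<omega> where \<omega>: "\<omega> \<notin> range \<alpha>" by blast
    have "t.span U = UNIV"
    proof (rule span_scattered_linear_set[OF vs(1,2) restrict])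
      show "scattered_linear_set s\<^sub>q s\<^sub>t U" using that ii by simp
      show "card U ^ 2 = CARD('fqn \<times> 'fqn)"
        unfolding card_U card_V by (simp add: mult.commute flip: power_mult)
      \<comment> \<open>Equality at a nonzero coordinate of \<open>v\<close> would give
        \<open>\<beta> \<omega> = \<beta> (\<alpha> c)\<close>, and injectivity of
        \<open>\<beta>\<close> would put \<open>\<omega>\<close> into the range of
        \<open>\<alpha>\<close>.\<close>
      show "s\<^sub>t \<omega> v \<noteq> s\<^sub>q c v" if "v \<noteq> 0" for c v
        using that \<omega>
        by (cases v) (auto simp: s\<^sub>q_def s\<^sub>t_def pair_scale_def zero_prod_def
            field_embedding_eq_iff[OF \<beta>])
    qed
    then have "proj_span s\<^sub>t R = points s\<^sub>t UNIV"
      by (simp add: R_def proj_span_points[OF vs(2)])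
    \<comment> \<open>For \<open>t = 2\<close> the rank \<open>n\<close> equals
      \<open>2 * t'\<close>, the vector space dimension required of a subgeometry.\<close>
    then show ?thesis
      using proj_dims(2) ranks(1) n \<open>t = 2\<close> by (simp add: canonical_subgeometry_def)
  qed

  show ?thesis
    using proj_dims ranks i ii bij iii by blast
qed

end
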